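(* Let $C_{213}(x,p,q,r)=\sum_{n\geq0}x^n\sum_{\sigma\in\mathcal{Q}_n(213)}p^{\mathrm{plat}(\sigma)}q^{\mathrm{des}(\sigma)}r^{\mathrm{asc}(\sigma)}$ (a formal power series in $x$ with polynomial coefficients in $p,q,r$), and let $f=C_{213}(x,p,q,r)-1$. Then $$f=xp+x(pr+qr+pq)f+xqr(r+p+q)f^2+xq^2r^2f^3.$$
   Context: A Stirling permutation of order $n$ is a permutation $\sigma=\sigma_1\cdots\sigma_{2n}$ of the multiset $\{1,1,2,2,\ldots,n,n\}$ such that, for each $i\in[n]$, every entry between the two occurrences of $i$ is greater than $i$; $\mathcal{Q}_n$ denotes the set of these ($\mathcal{Q}_0$ consists of the empty word). For $\sigma\in\mathcal{Q}_n$: $\mathrm{des}(\sigma)=\#\{i: 1\le i\le 2n-1,\ \sigma_i>\sigma_{i+1}\}$, $\mathrm{asc}(\sigma)=\#\{i: 1\le i\le 2n-1,\ \sigma_i<\sigma_{i+1}\}$, $\mathrm{plat}(\sigma)=\#\{i: 1\le i\le 2n-1,\ \sigma_i=\sigma_{i+1}\}$. $\mathcal{Q}_n(213)$ is the set of $\sigma\in\mathcal{Q}_n$ having no subsequence $\sigma_{i_1}\sigma_{i_2}\sigma_{i_3}$ ($i_1<i_2<i_3$) with $\sigma_{i_2}<\sigma_{i_1}<\sigma_{i_3}$. *)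

theory Defs
  imports
    "HOL-Library.Multiset"
    "HOL-Computational_Algebra.Polynomial"
    "HOL-Computational_Algebra.Formal_Power_Series"
begin

definition stirling_perms :: "nat \<Rightarrow> nat list set" where
  "stirling_perms n =
    {s. mset s = mset_set {1..n} + mset_set {1..n} \<and>
        (\<forall>i\<in>{1..n}. \<forall>a b c. a < b \<and> b < c \<and> c < length s \<and> s ! a = i \<and> s ! c = i
           \<longrightarrow> s ! b > i)}"

(* Positions are 0-based, so the paper's index i (1 <= i <= 2n-1) is Suc i here. *)

definition des :: "nat list \<Rightarrow> nat" where
  "des s = card {i. Suc i < length s \<and> s ! i > s ! Suc i}"

definition asc :: "nat list \<Rightarrow> nat" where
  "asc s = card {i. Suc i < length s \<and> s ! i < s ! Suc i}"

definition plat :: "nat list \<Rightarrow> nat" where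
  "plat s = card {i. Suc i < length s \<and> s ! i = s ! Suc i}"

definition avoids_213 :: "nat list \<Rightarrow> bool" where
  "avoids_213 s \<longleftrightarrow>
    \<not> (\<exists>a b c. a < b \<and> b < c \<and> c < length s \<and> s ! b < s ! a \<and> s ! a < s ! c)"

definition stirling_perms_213 :: "nat \<Rightarrow> nat list set" where
  "stirling_perms_213 n = {s \<in> stirling_perms n. avoids_213 s}"

(* The polynomial ring Z[p,q,r] is rendered as the iterated ring Z[p][q][r];
   the three constants below are its indeterminates. *)

type_synonym poly_pqr = "int poly poly poly"

definition var_p :: poly_pqr where
  "var_p = [:[:[:0, 1:]:]:]"

definition var_q :: poly_pqr where
  "var_q = [:[:0, 1:]:]"

definition var_r :: poly_pqr where
  "var_r = [:0, 1:]"

definition C213 :: "poly_pqr fps" where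
  "C213 = Abs_fps (\<lambda>n. \<Sum>s\<in>stirling_perms_213 n.
            var_p ^ plat s * var_q ^ des s * var_r ^ asc s)"

end

theory Submission
  imports Defs
begin

text \<open>
  Cut a nonempty word at the two occurrences of its smallest letter \<open>1\<close>, as \<open>A 1 B 1 C\<close>. Avoidance
  of 213 and the Stirling condition force every letter of \<open>A\<close> to exceed every letter of \<open>B\<close>, and
  every letter of \<open>B\<close> to exceed every letter of \<open>C\<close>, so that \<open>A\<close>, \<open>B\<close>, \<open>C\<close> are shifted copies of
  arbitrary 213-avoiding Stirling permutations. The letters \<open>1\<close> create one descent if \<open>A\<close> is
  nonempty, an ascent and a descent or else a plateau in the middle, and one ascent if \<open>C\<close> is
  nonempty. Hence \<open>f = x (1 + q f) (p + q r f) (1 + r f)\<close>.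
\<close>

section \<open>Conditions on triples of entries\<close>

text \<open>Recursion on the list, rather than quantified positions, lets concatenation and
  relabelling be handled by induction; \<open>triples_iff_nth\<close> returns to positions.\<close>

fun triples :: "('a \<Rightarrow> 'a \<Rightarrow> 'a \<Rightarrow> bool) \<Rightarrow> 'a list \<Rightarrow> bool" where
  "triples R [] \<longleftrightarrow> True"
| "triples R (x # xs) \<longleftrightarrow> sorted_wrt (R x) xs \<and> triples R xs"

lemma triples_iff_nth:
  "triples R s \<longleftrightarrow> (\<forall>a b c. a < b \<and> b < c \<and> c < length s \<longrightarrow> R (s ! a) (s ! b) (s ! c))"
proof (induction s)
  case (Cons x s)
  show ?case (is "_ \<longleftrightarrow> ?rhs")
  proof
    assume *: "triples R (x # s)"
    show ?rhs
    proof (intro allI impI, elim conjE)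
      fix a b c assume abc: "a < b" "b < c" "c < length (x # s)"
      then obtain b' c' where "b = Suc b'" "c = Suc c'"
        by (metis gr_implies_not0 not0_implies_Suc)
      with * abc Cons.IH show "R ((x # s) ! a) ((x # s) ! b) ((x # s) ! c)"
        by (cases a) (auto simp: sorted_wrt_iff_nth_less)
    qed
  next
    assume *: ?rhs
    have "R x (s ! b) (s ! c)" if "b < c" "c < length s" for b c
      using *[rule_format, of 0 "Suc b" "Suc c"] that by simp
    moreover have "R (s ! a) (s ! b) (s ! c)" if "a < b" "b < c" "c < length s" for a b c
      using *[rule_format, of "Suc a" "Suc b" "Suc c"] that by simp
    ultimately show "triples R (x # s)"
      using Cons.IH by (auto simp: sorted_wrt_iff_nth_less)
  qed
qed simp

text \<open>A triple straddling the cut has two entries on one side and one on the other, which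
  gives the two mixed conditions.\<close>

lemma triples_append:
  "triples R (xs @ ys) \<longleftrightarrow> triples R xs \<and> triples R ys \<and>
     (\<forall>z\<in>set ys. sorted_wrt (\<lambda>x y. R x y z) xs) \<and> (\<forall>x\<in>set xs. sorted_wrt (R x) ys)"
  by (induction xs) (auto simp: sorted_wrt_append)

lemma triples_map: "triples R (map g s) \<longleftrightarrow> triples (\<lambda>x y z. R (g x) (g y) (g z)) s"
  by (induction s) (auto simp: sorted_wrt_map)

lemma sorted_wrt_if_all:
  "(\<And>x y. x \<in> set xs \<Longrightarrow> y \<in> set xs \<Longrightarrow> P x y) \<Longrightarrow> sorted_wrt P xs"
  by (induction xs) auto

text \<open>The first conjunct is the Stirling condition, the second excludes the pattern 213; one
  relation lets both travel through the decomposition together.\<close>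

definition stirling_213 :: "nat \<Rightarrow> nat \<Rightarrow> nat \<Rightarrow> bool" where
  "stirling_213 x y z \<longleftrightarrow> (x = z \<longrightarrow> x < y) \<and> (x < z \<longrightarrow> x \<le> y)"

text \<open>An arbitrary interval of letters is allowed because the blocks of a decomposed word do
  not start at the letter 1.\<close>

definition stirling_words :: "nat \<Rightarrow> nat \<Rightarrow> nat list set" where
  "stirling_words l m =
     {s. mset s = mset_set {l<..m} + mset_set {l<..m} \<and> triples stirling_213 s}"

lemma set_stirling_words: "s \<in> stirling_words l m \<Longrightarrow> set s = {l<..m}"
  by (auto simp: stirling_words_def simp flip: set_mset_mset)

lemma length_stirling_words: "s \<in> stirling_words l m \<Longrightarrow> length s = 2 * (m - l)"
  by (auto simp: stirling_words_def simp flip: size_mset)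

lemma finite_stirling_words: "finite (stirling_words l m)"
proof (rule finite_subset)
  show "stirling_words l m \<subseteq> {s. set s \<subseteq> {l<..m} \<and> length s = 2 * (m - l)}"
    by (auto simp: set_stirling_words length_stirling_words)
qed (simp add: finite_lists_length_eq)

lemma stirling_words_empty: "stirling_words l l = {[]}"
  by (auto simp: stirling_words_def)

lemma stirling_perms_213_eq: "stirling_perms_213 n = stirling_words 0 n"
proof -
  have I: "{1..n} = {0<..n}" by auto
  \<comment> \<open>The Stirling condition speaks of letters in the alphabet only,
    \<open>stirling_213\<close> of all entries; the multiset condition reconciles them.\<close>
  have "(\<forall>i\<in>{0<..n}. \<forall>a b c. a < b \<and> b < c \<and> c < length s \<and> s ! a = i \<and> s ! c = i \<longrightarrow> s ! b > i)
          \<and> avoids_213 s \<longleftrightarrow> triples stirling_213 s"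
    if "mset s = mset_set {0<..n} + mset_set {0<..n}" for s
  proof -
    have "set s = {0<..n}" using that by (auto simp flip: set_mset_mset)
    then have "s ! a \<in> {0<..n}" if "a < length s" for a
      using that nth_mem by blast
    then show ?thesis
      unfolding triples_iff_nth stirling_213_def avoids_213_def
      by (smt (verit, best) linorder_not_less order.strict_trans)
  qed
  then show ?thesis
    unfolding stirling_perms_213_def stirling_perms_def stirling_words_def I by blast
qed

section \<open>Translation of the alphabet\<close>

lemma image_mset_add_interval:
  "image_mset (\<lambda>x. x + d) (mset_set {l<..m}) = mset_set {l + d<..m + (d::nat)}"
proof -
  have "(\<lambda>x. x + d) ` {l<..m} = {l + d<..m + d}"
  proof (intro equalityI subsetI)
    fix x assume "x \<in> {l + d<..m + d}"
    then show "x \<in> (\<lambda>x. x + d) ` {l<..m}" by (intro image_eqI[of _ _ "x - d"]) auto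
  qed auto
  then show ?thesis by (simp add: image_mset_mset_set inj_on_def)
qed

lemma map_add_stirling_words_iff:
  "map (\<lambda>x. x + d) s \<in> stirling_words (l + d) (m + d) \<longleftrightarrow> s \<in> stirling_words l m"
proof -
  have "inj (image_mset (\<lambda>x::nat. x + d))"
    by (rule inj_on_inverseI[of _ "image_mset (\<lambda>x. x - d)"]) (simp add: multiset.map_comp comp_def)
  then have "image_mset (\<lambda>x. x + d) (mset s) = image_mset (\<lambda>x. x + d) M \<longleftrightarrow> mset s = M" for M
    by (simp add: inj_eq)
  from this[of "mset_set {l<..m} + mset_set {l<..m}"]
  have "mset (map (\<lambda>x. x + d) s) = mset_set {l + d<..m + d} + mset_set {l + d<..m + d} \<longleftrightarrow>
      mset s = mset_set {l<..m} + mset_set {l<..m}"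
    by (simp add: image_mset_add_interval)
  moreover have "stirling_213 (x + d) (y + d) (z + d) = stirling_213 x y z" for x y z
    by (simp add: stirling_213_def)
  ultimately show ?thesis
    by (simp add: stirling_words_def triples_map)
qed

lemma stirling_wordsE:
  assumes "s \<in> stirling_words l m" "l \<le> m"
  obtains t where "t \<in> stirling_words 0 (m - l)" "s = map (\<lambda>x. x + l) t"
proof
  \<comment> \<open>This bound makes the truncated subtraction of \<open>l\<close>
    reversible.\<close>
  have "\<forall>x\<in>set s. l \<le> x" using set_stirling_words[OF assms(1)] by auto
  then show s: "s = map (\<lambda>x. x + l) (map (\<lambda>x. x - l) s)"
    by (induction s) auto
  show "map (\<lambda>x. x - l) s \<in> stirling_words 0 (m - l)"
    using assms s map_add_stirling_words_iff[of l "map (\<lambda>x. x - l) s" 0 "m - l"] by simp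
qed

section \<open>Decomposition at the smallest letter\<close>

text \<open>Turns the domination of one block by another into intervals of letters, as
  \<open>stirling_words\<close> demands.\<close>

lemma interval_cut:
  fixes l m :: nat
  assumes "U \<union> V = {l<..m}" "\<And>u v. u \<in> U \<Longrightarrow> v \<in> V \<Longrightarrow> v < u" "l \<le> m"
  obtains k where "l \<le> k" "k \<le> m" "V = {l<..k}" "U = {k<..m}"
proof -
  \<comment> \<open>Inserting \<open>l\<close> covers an empty \<open>V\<close>, for which the cut
    is at \<open>l\<close>.\<close>
  define k where "k = Max (insert l V)"
  have fin: "finite V" using assms(1) by (metis finite_Un finite_greaterThanAtMost)
  have k: "k \<in> insert l V" unfolding k_def by (rule Max_in) (use fin in auto)
  have ub: "v \<le> k" if "v \<in> V" for v unfolding k_def using fin that by simp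
  have lk: "l \<le> k" unfolding k_def using fin by simp
  have km: "k \<le> m" using k assms(1,3) by auto
  have Uk: "k < u" if "u \<in> U" for u
  proof -
    have "u \<in> {l<..m}" using assms(1) that by blast
    then show ?thesis using k assms(2) that by auto
  qed
  have mem: "x \<in> U \<or> x \<in> V \<longleftrightarrow> l < x \<and> x \<le> m" for x
    using assms(1) by (metis Un_iff greaterThanAtMost_iff)
  show ?thesis
  proof (rule that[OF lk km])
    show "V = {l<..k}" "U = {k<..m}"
      using mem ub Uk km lk by (auto simp: set_eq_iff) (meson leD le_trans le_less_trans)+
  qed
qed

text \<open>Each letter occurs twice, so half the length of a block is its number of distinct
  letters. A block is shifted past all letters of the later blocks and past the letter 1.\<close>

definition join :: "nat list \<times> nat list \<times> nat list \<Rightarrow> nat list" where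
  "join = (\<lambda>(A, B, C). map (\<lambda>x. x + (length C div 2 + length B div 2 + 1)) A @
       1 # map (\<lambda>x. x + (length C div 2 + 1)) B @ 1 # map (\<lambda>x. x + 1) C)"

text \<open>Both sides are cut at the first occurrence of \<open>x\<close>.\<close>

lemma split_unique:
  assumes "A @ x # B = A' @ x # B'" "x \<notin> set A" "x \<notin> set A'"
  shows "A = A' \<and> B = B'"
  using assms by (induction A arbitrary: A') (auto simp: Cons_eq_append_conv append_eq_Cons_conv)

text \<open>Positive letters exceed 1 once shifted, so the first two letters 1 of the joined word
  are the separators.\<close>

lemma join_inj:
  assumes "0 \<notin> set A" "0 \<notin> set B" "0 \<notin> set A'" "0 \<notin> set B'"
    and "join (A, B, C) = join (A', B', C')"
  shows "(A, B, C) = (A', B', C')"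
proof -
  have inj: "inj (\<lambda>x::nat. x + d)" for d by (simp add: inj_on_def)
  note eq = assms(5)[unfolded join_def prod.case]
  note eq1 = split_unique[OF eq]
  have *: "map (\<lambda>x. x + (length C div 2 + 1)) B @ 1 # map (\<lambda>x. x + 1) C =
           map (\<lambda>x. x + (length C' div 2 + 1)) B' @ 1 # map (\<lambda>x. x + 1) C'"
    "map (\<lambda>x. x + (length C div 2 + length B div 2 + 1)) A =
     map (\<lambda>x. x + (length C' div 2 + length B' div 2 + 1)) A'"
    using eq1 assms(1,3) by force+
  have **: "map (\<lambda>x. x + (length C div 2 + 1)) B = map (\<lambda>x. x + (length C' div 2 + 1)) B'"
    "map (\<lambda>x. x + 1) C = map (\<lambda>x. x + 1) C'"
    using split_unique[OF *(1)] assms(2,4) by force+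
  \<comment> \<open>Each shift depends on the lengths of the later blocks, so the blocks are
    recovered from right to left.\<close>
  from **(2) have C: "C = C'" by (simp only: inj_map_eq_map[OF inj])
  from **(1) have B: "B = B'" unfolding C by (simp only: inj_map_eq_map[OF inj])
  from *(2) have "A = A'" unfolding B C by (simp only: inj_map_eq_map[OF inj])
  with B C show ?thesis by simp
qed

lemma concat_mem_stirling_words:
  assumes ord: "Suc l \<le> k" "k \<le> j" "j \<le> m"
    and mem: "A \<in> stirling_words j m" "B \<in> stirling_words k j" "C \<in> stirling_words (Suc l) k"
  shows "A @ Suc l # B @ Suc l # C \<in> stirling_words l m"
proof -
  have sets: "set A = {j<..m}" "set B = {k<..j}" "set C = {Suc l<..k}"
    using mem by (simp_all add: set_stirling_words)
  have "{l<..m} = insert (Suc l) ({j<..m} \<union> ({k<..j} \<union> {Suc l<..k}))"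
    using ord by auto
  also have "mset_set \<dots> =
      add_mset (Suc l) (mset_set {j<..m} + (mset_set {k<..j} + mset_set {Suc l<..k}))"
  proof -
    have "{k<..j} \<inter> {Suc l<..k} = {}" "{j<..m} \<inter> ({k<..j} \<union> {Suc l<..k}) = {}"
      "Suc l \<notin> {j<..m} \<union> ({k<..j} \<union> {Suc l<..k})"
      using ord by auto
    then show ?thesis by (simp add: mset_set_Union)
  qed
  finally have "mset (A @ Suc l # B @ Suc l # C) = mset_set {l<..m} + mset_set {l<..m}"
    using mem by (simp add: stirling_words_def)
  \<comment> \<open>In a triple x, y, z not inside one block, either x > z or x is the least letter
    \<open>Suc l\<close>. If z is \<open>Suc l\<close> as well, then y lies in \<open>B\<close> and
    is larger.\<close>
  moreover have "triples stirling_213 (A @ Suc l # B @ Suc l # C)"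
    using mem ord
    by (auto simp: stirling_words_def triples_append sorted_wrt_append sets stirling_213_def
        intro!: sorted_wrt_if_all)
  ultimately show ?thesis by (simp add: stirling_words_def)
qed

text \<open>The separating letter \<open>Suc l\<close>, taken as the middle entry of a triple,
  forces the order of the blocks; their multisets then follow by counting.\<close>

lemma stirling_words_split:
  assumes s: "s \<in> stirling_words l m" and "l < m"
  obtains A B C j k where "s = A @ Suc l # B @ Suc l # C" "Suc l \<le> k" "k \<le> j" "j \<le> m"
    "A \<in> stirling_words j m" "B \<in> stirling_words k j" "C \<in> stirling_words (Suc l) k"
proof -
  have cnt: "count (mset s) x = (if l < x \<and> x \<le> m then 2 else 0)" for x
    using s by (simp add: stirling_words_def count_mset_set')
  have tr: "triples stirling_213 s" using s by (simp add: stirling_words_def)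
  have "Suc l \<in> set s" using set_stirling_words[OF s] \<open>l < m\<close> by simp
  then obtain A T where sA: "s = A @ Suc l # T" and A1: "Suc l \<notin> set A"
    using split_list_first by metis
  have "count (mset T) (Suc l) = 1"
    using cnt[of "Suc l"] A1 \<open>l < m\<close> by (simp add: sA flip: count_mset_0_iff)
  then have "Suc l \<in> set T" by (metis count_mset_0_iff zero_neq_one)
  then obtain B C where T: "T = B @ Suc l # C" and B1: "Suc l \<notin> set B"
    using split_list_first by metis
  have C1: "Suc l \<notin> set C"
    using \<open>count (mset T) (Suc l) = 1\<close> B1 by (simp add: T flip: count_mset_0_iff)
  have sABC: "s = A @ Suc l # B @ Suc l # C" using sA T by simp
  have big: "Suc l < x" if "x \<in> set A \<union> set B \<union> set C" for x
  proof -
    have "l < x" using that set_stirling_words[OF s] by (auto simp: sABC)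
    moreover have "x \<noteq> Suc l" using that A1 B1 C1 by auto
    ultimately show ?thesis by simp
  qed
  \<comment> \<open>Since x exceeds the middle entry \<open>Suc l\<close>, both x = z and x < z
    would violate \<open>stirling_213\<close>.\<close>
  have A_gt: "z < x" if "x \<in> set A" "z \<in> set B \<union> set C" for x z
  proof -
    have "stirling_213 x (Suc l) z"
      using tr that by (auto simp: sABC triples_append)
    then show ?thesis using big[of x] that by (auto simp: stirling_213_def not_less)
  qed
  have B_gt: "z < x" if "x \<in> set B" "z \<in> set C" for x z
  proof -
    have "stirling_213 x (Suc l) z"
      using tr that by (auto simp: sABC triples_append sorted_wrt_append)
    then show ?thesis using big[of x] that by (auto simp: stirling_213_def not_less)
  qed
  have "set A \<union> (set B \<union> set C) = {Suc l<..m}"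
  proof -
    have "insert (Suc l) (set A \<union> (set B \<union> set C)) = {l<..m}"
      using set_stirling_words[OF s] by (auto simp: sABC)
    moreover have "Suc l \<notin> set A \<union> (set B \<union> set C)" using A1 B1 C1 by simp
    ultimately have "set A \<union> (set B \<union> set C) = {l<..m} - {Suc l}" by blast
    also have "\<dots> = {Suc l<..m}" by auto
    finally show ?thesis .
  qed
  from interval_cut[OF this A_gt] \<open>l < m\<close> obtain j
    where j: "Suc l \<le> j" "j \<le> m" "set B \<union> set C = {Suc l<..j}" "set A = {j<..m}"
    by auto
  from interval_cut[OF j(3) B_gt j(1)] obtain k
    where k: "Suc l \<le> k" "k \<le> j" "set C = {Suc l<..k}" "set B = {k<..j}"
    by auto
  have trs: "triples stirling_213 A" "triples stirling_213 B" "triples stirling_213 C"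
    using tr by (auto simp: sABC triples_append)
  \<comment> \<open>Every remaining letter occurs twice in total and belongs to only one of the
    three disjoint intervals, so both copies lie in the same block.\<close>
  have cnt': "count (mset A) x + count (mset B) x + count (mset C) x =
      (if Suc l < x \<and> x \<le> m then 2 else 0)"
    if "x \<noteq> Suc l" for x
    using cnt[of x] that by (auto simp: sABC split: if_splits)
  have zero: "x \<notin> {j<..m} \<Longrightarrow> count (mset A) x = 0" "x \<notin> {k<..j} \<Longrightarrow> count (mset B) x = 0"
    "x \<notin> {Suc l<..k} \<Longrightarrow> count (mset C) x = 0" for x
    using j(4) k(3,4) by (simp_all add: count_mset_0_iff)
  have "mset A = mset_set {j<..m} + mset_set {j<..m} \<and> mset B = mset_set {k<..j} + mset_set {k<..j}
      \<and> mset C = mset_set {Suc l<..k} + mset_set {Suc l<..k}"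
  proof (intro conjI multiset_eqI)
    fix x
    show "count (mset A) x = count (mset_set {j<..m} + mset_set {j<..m}) x"
      using cnt'[of x] zero[of x] j(1,2) k(1,2)
      by (cases "x \<in> {j<..m}") (auto simp: count_mset_set' simp del: count_mset_0_iff)
    show "count (mset B) x = count (mset_set {k<..j} + mset_set {k<..j}) x"
      using cnt'[of x] zero[of x] j(1,2) k(1,2)
      by (cases "x \<in> {k<..j}") (auto simp: count_mset_set' simp del: count_mset_0_iff)
    show "count (mset C) x = count (mset_set {Suc l<..k} + mset_set {Suc l<..k}) x"
      using cnt'[of x] zero[of x] j(1,2) k(1,2)
      by (cases "x \<in> {Suc l<..k}") (auto simp: count_mset_set' simp del: count_mset_0_iff)
  qed
  then show ?thesis
    using that[OF sABC k(1,2) j(2)] trs by (simp add: stirling_words_def)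
qed

section \<open>The bijection between triples of blocks and words\<close>

definition pairs_of_size ::
  "(nat \<Rightarrow> 'a set) \<Rightarrow> (nat \<Rightarrow> 'b set) \<Rightarrow> nat \<Rightarrow> ('a \<times> 'b) set" where
  "pairs_of_size P Q n = (\<Union>i\<in>{0..n}. P i \<times> Q (n - i))"

abbreviation "Q213 \<equiv> stirling_words 0"

text \<open>The sizes of the three blocks add up to \<open>n\<close>; the separating letter 1
  supplies the remaining unit of \<open>Suc n\<close>.\<close>

lemma bij_betw_join:
  "bij_betw join (pairs_of_size Q213 (pairs_of_size Q213 Q213) n) (Q213 (Suc n))"
proof (rule bij_betwI')
  fix S T
  assume S: "S \<in> pairs_of_size Q213 (pairs_of_size Q213 Q213) n"
    and T: "T \<in> pairs_of_size Q213 (pairs_of_size Q213 Q213) n"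
  show "join S = join T \<longleftrightarrow> S = T"
  proof
    assume eq: "join S = join T"
    obtain A B C A' B' C' where "S = (A, B, C)" "T = (A', B', C')"
      by (metis prod_cases3)
    moreover from this have "0 \<notin> set A" "0 \<notin> set B" "0 \<notin> set A'" "0 \<notin> set B'"
      using S T by (auto simp: pairs_of_size_def dest: set_stirling_words)
    ultimately show "S = T" using join_inj eq by metis
  qed simp
next
  fix S assume "S \<in> pairs_of_size Q213 (pairs_of_size Q213 Q213) n"
  then obtain A B C i j where S: "S = (A, B, C)" and le: "i \<le> n" "j \<le> n - i"
    and mem: "A \<in> Q213 i" "B \<in> Q213 j" "C \<in> Q213 (n - i - j)"
    by (auto simp: pairs_of_size_def)
  let ?k = "n - i - j"
  have len: "length C div 2 = ?k" "length B div 2 = j"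
    using mem by (auto dest: length_stirling_words)
  have "map (\<lambda>x. x + (?k + j + 1)) A \<in> stirling_words (?k + j + 1) (Suc n)"
    using mem(1) le map_add_stirling_words_iff[of "?k + j + 1" A 0 i] by simp
  moreover have "map (\<lambda>x. x + (?k + 1)) B \<in> stirling_words (?k + 1) (?k + j + 1)"
    using mem(2) le map_add_stirling_words_iff[of "?k + 1" B 0 j] by (simp add: add_ac)
  moreover have "map (\<lambda>x. x + 1) C \<in> stirling_words (Suc 0) (?k + 1)"
    using mem(3) map_add_stirling_words_iff[of 1 C 0 ?k] by simp
  ultimately show "join S \<in> Q213 (Suc n)"
    using concat_mem_stirling_words[of 0 "?k + 1" "?k + j + 1" "Suc n"] le
    by (simp add: S join_def len)
next
  fix s assume "s \<in> Q213 (Suc n)"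
  then obtain A B C j k where s: "s = A @ Suc 0 # B @ Suc 0 # C" "Suc 0 \<le> k" "k \<le> j" "j \<le> Suc n"
    "A \<in> stirling_words j (Suc n)" "B \<in> stirling_words k j" "C \<in> stirling_words (Suc 0) k"
    by (rule stirling_words_split) simp
  \<comment> \<open>For surjectivity the three blocks are translated back to alphabets starting at
    1; their sizes are \<open>Suc n - j\<close>, \<open>j - k\<close> and
    \<open>k - 1\<close>.\<close>
  from s(5) obtain A' where A: "A' \<in> Q213 (Suc n - j)" "A = map (\<lambda>x. x + j) A'"
    by (rule stirling_wordsE) (use s in auto)
  from s(6) obtain B' where B: "B' \<in> Q213 (j - k)" "B = map (\<lambda>x. x + k) B'"
    by (rule stirling_wordsE) (use s in auto)
  from s(7) obtain C' where C: "C' \<in> Q213 (k - Suc 0)" "C = map (\<lambda>x. x + Suc 0) C'"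
    by (rule stirling_wordsE) (use s in auto)
  have len: "length C' div 2 = k - 1" "length B' div 2 = j - k"
    using B C by (auto dest: length_stirling_words)
  have "join (A', B', C') = s"
    using s(2,3) by (simp add: join_def len s(1) A(2) B(2) C(2))
  moreover have "(A', B', C') \<in> pairs_of_size Q213 (pairs_of_size Q213 Q213) n"
  proof -
    have "k - Suc 0 = n - (Suc n - j) - (j - k)" using s(2-4) by simp
    then have "(B', C') \<in> pairs_of_size Q213 Q213 (n - (Suc n - j))"
      using B(1) C(1) s(2-4) unfolding pairs_of_size_def
      by (intro UN_I[of "j - k"]) auto
    then show ?thesis
      using A(1) s(2-4) unfolding pairs_of_size_def[of _ _ n]
      by (intro UN_I[of "Suc n - j"]) auto
  qed
  ultimately show "\<exists>S\<in>pairs_of_size Q213 (pairs_of_size Q213 Q213) n. s = join S"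
    by metis
qed

section \<open>Weights\<close>

text \<open>Covers plateaus, descents and ascents at once, so that one recursion serves all three
  statistics.\<close>

definition adjacent :: "('a \<Rightarrow> 'a \<Rightarrow> bool) \<Rightarrow> 'a list \<Rightarrow> nat" where
  "adjacent R s = card {i. Suc i < length s \<and> R (s ! i) (s ! Suc i)}"

lemma adjacent_Nil [simp]: "adjacent R [] = 0"
  and adjacent_single [simp]: "adjacent R [x] = 0"
  by (simp_all add: adjacent_def)

lemma adjacent_Cons [simp]:
  "adjacent R (x # y # s) = of_bool (R x y) + adjacent R (y # s)"
proof -
  let ?I = "{i. Suc i < length (y # s) \<and> R ((y # s) ! i) ((y # s) ! Suc i)}"
  have "finite ?I" by (rule finite_subset[of _ "{..<length (y # s)}"]) auto
  moreover have "{i. Suc i < length (x # y # s) \<and> R ((x # y # s) ! i) ((x # y # s) ! Suc i)}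
      = (if R x y then {0} else {}) \<union> Suc ` ?I"
  proof (rule set_eqI)
    fix i
    show "i \<in> {i. Suc i < length (x # y # s) \<and> R ((x # y # s) ! i) ((x # y # s) ! Suc i)}
      \<longleftrightarrow> i \<in> (if R x y then {0} else {}) \<union> Suc ` ?I"
      by (cases i) auto
  qed
  ultimately show ?thesis
    by (auto simp: adjacent_def card_image card_insert_if)
qed

definition weight :: "nat list \<Rightarrow> poly_pqr" where
  "weight s = var_p ^ plat s * var_q ^ des s * var_r ^ asc s"

definition step_weight :: "nat \<Rightarrow> nat \<Rightarrow> poly_pqr" where
  "step_weight x y = (if x = y then var_p else if x > y then var_q else var_r)"

lemma weight_eq_adjacent:
  "weight s = var_p ^ adjacent (=) s * var_q ^ adjacent (>) s * var_r ^ adjacent (<) s"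
  by (simp add: weight_def plat_def des_def asc_def adjacent_def)

text \<open>The weight is a product over neighbouring pairs, which makes it multiplicative along a
  cut.\<close>

lemma weight_Nil [simp]: "weight [] = 1"
  and weight_single [simp]: "weight [x] = 1"
  and weight_Cons [simp]: "weight (x # y # s) = step_weight x y * weight (y # s)"
  by (auto simp: weight_eq_adjacent step_weight_def)

text \<open>The letter \<open>y\<close> appears in both factors so that each neighbouring pair is
  counted in exactly one of them.\<close>

lemma weight_append_Cons: "weight (xs @ y # ys) = weight (xs @ [y]) * weight (y # ys)"
proof (induction xs)
  case (Cons x xs)
  then show ?case by (cases xs) (simp_all add: mult_ac)
qed simp

lemma weight_snoc:
  "weight (xs @ [y]) = (if xs = [] then 1 else weight xs * step_weight (last xs) y)"
proof (induction xs)
  case (Cons x xs)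
  then show ?case by (cases xs) (simp_all add: mult_ac)
qed simp

lemma weight_Cons_if:
  "weight (x # xs) = (if xs = [] then 1 else step_weight x (hd xs) * weight xs)"
  by (cases xs) simp_all

lemma weight_map_add [simp]: "weight (map (\<lambda>x. x + d) s) = weight s"
proof (induction s)
  case (Cons x s)
  then show ?case by (cases s) (simp_all add: step_weight_def)
qed simp

text \<open>The weight of a block together with the steps to and from the neighbouring letters \<open>1\<close>;
  the argument \<open>e\<close> is the contribution of an empty block.\<close>

definition block_weight :: "poly_pqr \<Rightarrow> poly_pqr \<Rightarrow> nat list \<Rightarrow> poly_pqr" where
  "block_weight e v s = (if s = [] then e else v * weight s)"

text \<open>Shifted letters exceed 1, so entering a block from a 1 is an ascent and leaving it
  towards a 1 is a descent. \<open>A\<close> is only left, \<open>C\<close> only entered, and an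
  empty \<open>B\<close> leaves the plateau 11.\<close>

lemma weight_join:
  assumes "0 \<notin> set A" "0 \<notin> set B" "0 \<notin> set C"
  shows "weight (join (A, B, C)) = block_weight 1 var_q A *
    (block_weight var_p (var_q * var_r) B * block_weight 1 var_r C)"
proof -
  have gt: "step_weight (last (map (\<lambda>x. x + Suc d) s)) 1 = var_q"
    "step_weight 1 (hd (map (\<lambda>x. x + Suc d) s)) = var_r"
    if "s \<noteq> []" "0 \<notin> set s" for s d
    using that last_in_set[OF that(1)] hd_in_set[OF that(1)]
    by (cases "last s"; cases "hd s"; auto simp: step_weight_def last_map hd_map)+
  have "weight (xs @ 1 # ys @ 1 # zs) = weight (xs @ [1]) * (weight (1 # ys @ [1]) * weight (1 # zs))"
    for xs ys zs
    using weight_append_Cons[of xs 1 "ys @ 1 # zs"] weight_append_Cons[of "1 # ys" 1 zs] by simp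
  moreover have "weight (map (\<lambda>x. x + Suc d) A @ [1]) = block_weight 1 var_q A" for d
    using gt(1)[of A d] assms(1) weight_map_add[of "Suc d"]
    by (auto simp: weight_snoc block_weight_def mult_ac)
  moreover have "weight (1 # map (\<lambda>x. x + Suc d) B @ [1]) =
      block_weight var_p (var_q * var_r) B" for d
  proof (cases "B = []")
    case False
    then have "weight (1 # map (\<lambda>x. x + Suc d) B @ [1]) =
        step_weight 1 (hd (map (\<lambda>x. x + Suc d) B)) * weight (map (\<lambda>x. x + Suc d) B @ [1])"
      by (subst weight_Cons_if) (simp add: hd_append)
    with False show ?thesis
      using gt[of B d] assms(2) weight_map_add[of "Suc d" B]
      by (simp add: weight_snoc block_weight_def mult_ac)
  qed (simp add: block_weight_def step_weight_def)
  moreover have "weight (1 # map Suc C) = block_weight 1 var_r C"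
    using gt(2)[of C 0] assms(3) weight_map_add[of 1]
    by (auto simp: weight_Cons_if[of "Suc 0"] block_weight_def)
  ultimately show ?thesis
    by (simp add: join_def)
qed

section \<open>Generating functions\<close>

definition genfun :: "(nat \<Rightarrow> 'a set) \<Rightarrow> ('a \<Rightarrow> 'b::comm_ring_1) \<Rightarrow> 'b fps" where
  "genfun P w = Abs_fps (\<lambda>n. \<Sum>s\<in>P n. w s)"

lemma finite_pairs_of_size:
  "(\<And>n. finite (P n)) \<Longrightarrow> (\<And>n. finite (Q n)) \<Longrightarrow> finite (pairs_of_size P Q n)"
  by (simp add: pairs_of_size_def)

text \<open>Disjointness of the classes \<open>P i\<close> makes the size of the first component
  unique, so the sum over pairs is the Cauchy product.\<close>

lemma genfun_mult:
  assumes "\<And>n. finite (P n)" "\<And>n. finite (Q n)" "\<And>i j. i \<noteq> j \<Longrightarrow> P i \<inter> P j = {}"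
  shows "genfun P v * genfun Q w = genfun (pairs_of_size P Q) (\<lambda>(s, t). v s * w t)"
proof (rule fps_ext)
  fix n
  have "(\<Sum>(s, t)\<in>pairs_of_size P Q n. v s * w t)
      = (\<Sum>i=0..n. \<Sum>(s, t)\<in>P i \<times> Q (n - i). v s * w t)"
    unfolding pairs_of_size_def
  proof (rule sum.UNION_disjoint)
    show "\<forall>i\<in>{0..n}. \<forall>j\<in>{0..n}. i \<noteq> j \<longrightarrow> P i \<times> Q (n - i) \<inter> P j \<times> Q (n - j) = {}"
      using assms(3) by blast
  qed (use assms in auto)
  also have "\<dots> = (\<Sum>i=0..n. (\<Sum>s\<in>P i. v s) * (\<Sum>t\<in>Q (n - i). w t))"
    by (simp add: sum_product sum.cartesian_product)
  finally show "fps_nth (genfun P v * genfun Q w) n =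
      fps_nth (genfun (pairs_of_size P Q) (\<lambda>(s, t). v s * w t)) n"
    by (simp add: genfun_def fps_mult_nth)
qed

lemma disjoint_Q213: "i \<noteq> j \<Longrightarrow> Q213 i \<inter> Q213 j = {}"
  by (auto dest!: length_stirling_words)

lemma C213_eq_genfun: "C213 = genfun Q213 weight"
  by (simp add: C213_def genfun_def weight_def stirling_perms_213_eq)

text \<open>The empty word is the only word of size 0, so \<open>C213 - 1\<close> enumerates exactly
  the nonempty blocks.\<close>

lemma genfun_block_weight:
  "genfun Q213 (block_weight e v) = fps_const e + fps_const v * (C213 - 1)"
proof (rule fps_ext)
  fix n
  show "fps_nth (genfun Q213 (block_weight e v)) n =
      fps_nth (fps_const e + fps_const v * (C213 - 1)) n"
  proof (cases n)
    case 0
    then show ?thesis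
      by (simp add: genfun_def C213_eq_genfun stirling_words_empty block_weight_def)
  next
    case (Suc m)
    have "s \<noteq> []" if "s \<in> Q213 n" for s
      using length_stirling_words[OF that] Suc by auto
    then have "(\<Sum>s\<in>Q213 n. block_weight e v s) = v * (\<Sum>s\<in>Q213 n. weight s)"
      by (simp add: block_weight_def sum_distrib_left)
    then show ?thesis
      using Suc by (simp add: genfun_def C213_eq_genfun)
  qed
qed

lemma C213_recurrence:
  "C213 = 1 + fps_X * (genfun Q213 (block_weight 1 var_q) *
     (genfun Q213 (block_weight var_p (var_q * var_r)) * genfun Q213 (block_weight 1 var_r)))"
proof (rule fps_ext)
  fix n
  let ?F = "genfun Q213 (block_weight 1 var_q) *
     (genfun Q213 (block_weight var_p (var_q * var_r)) * genfun Q213 (block_weight 1 var_r))"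
  let ?D = "pairs_of_size Q213 (pairs_of_size Q213 Q213)"
  have F: "?F = genfun ?D (\<lambda>(A, B, C). block_weight 1 var_q A *
      (block_weight var_p (var_q * var_r) B * block_weight 1 var_r C))"
    by (simp add: genfun_mult finite_pairs_of_size finite_stirling_words disjoint_Q213
        case_prod_unfold)
  show "fps_nth C213 n = fps_nth (1 + fps_X * ?F) n"
  proof (cases n)
    case 0
    then show ?thesis by (simp add: C213_eq_genfun genfun_def stirling_words_empty)
  next
    case (Suc m)
    \<comment> \<open>Words of size \<open>Suc m\<close> are reindexed by triples of total size
      \<open>m\<close>; the factor \<open>fps_X\<close> absorbs the difference.\<close>
    have "fps_nth C213 n = (\<Sum>S\<in>?D m. weight (join S))"
      unfolding C213_eq_genfun genfun_def Suc
      by (simp add: sum.reindex_bij_betw[OF bij_betw_join])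
    also have "\<dots> = fps_nth ?F m"
    proof -
      have "0 \<notin> set A" "0 \<notin> set B" "0 \<notin> set C" if "(A, B, C) \<in> ?D m" for A B C
        using that by (auto simp: pairs_of_size_def dest: set_stirling_words)
      then show ?thesis
        unfolding F unfolding genfun_def by (auto intro!: sum.cong simp: weight_join)
    qed
    finally show ?thesis using Suc by simp
  qed
qed

theorem theorem2p1:
  fixes x p q r f :: "poly_pqr fps"
  assumes "x = fps_X" and "p = fps_const var_p" and "q = fps_const var_q"
    and "r = fps_const var_r"
    and "f = C213 - 1"
  shows "f = x * p + x * (p * r + q * r + p * q) * f
           + x * q * r * (r + p + q) * f ^ 2 + x * q ^ 2 * r ^ 2 * f ^ 3"
proof -
  \<comment> \<open>The recurrence with its three block series expressed through \<open>f\<close>,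
    after cancelling the 1 of the empty word.\<close>
  have "f = x * ((1 + q * f) * ((p + q * r * f) * (1 + r * f)))"
    using C213_recurrence
    unfolding genfun_block_weight assms fps_const_mult[symmetric] fps_const_1_eq_1
    by (metis add_diff_cancel_left')
  also have "\<dots> = x * p + x * (p * r + q * r + p * q) * f
           + x * q * r * (r + p + q) * f ^ 2 + x * q ^ 2 * r ^ 2 * f ^ 3"
    by (simp add: algebra_simps power2_eq_square power3_eq_cube)
  finally show ?thesis .
qed

end
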